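(* Let $\rho>1$, $\hat\sigma_{\mathrm w}^2>0$, $P_{\mathrm b},P_{\mathrm c}\ge 0$, $\mathbf h_{\mathrm{rw}},\mathbf h_{\mathrm{AR}}\in\mathbb C^{M\times 1}$, and let $\boldsymbol\Theta_{\mathrm r}$ be a reflection coefficient matrix of the STAR-RIS. Set $\phi_1=P_{\mathrm c}\left|\mathbf h_{\mathrm{rw}}^H\boldsymbol\Theta_{\mathrm r}\mathbf h_{\mathrm{AR}}\right|^2$ and $\phi_2=(P_{\mathrm b}+P_{\mathrm c})\left|\mathbf h_{\mathrm{rw}}^H\boldsymbol\Theta_{\mathrm r}\mathbf h_{\mathrm{AR}}\right|^2$. Then the minimum $P_{\mathrm e}^*$ of the detection error probability $P_{\mathrm e}$ at Willie over detection thresholds $\tau_{\mathrm{dt}}\in\left[\frac{\hat\sigma_{\mathrm w}^2}{\rho}+\phi_1,\ \rho\hat\sigma_{\mathrm w}^2+\phi_1\right]$ is $$P_{\mathrm e}^*=\begin{cases}1-\dfrac{\ln\left(1+\frac{\rho(\phi_2-\phi_1)}{\hat\sigma_{\mathrm w}^2}\right)}{2\ln\rho}, & \phi_2-\phi_1\le\dfrac{(\rho^2-1)\hat\sigma_{\mathrm w}^2}{\rho},\\[2mm] 0, & \text{otherwise}.\end{cases}$$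
   Context: Setting: a single-antenna transmitter (Alice) serves a covert user (Bob) with power $P_{\mathrm b}$ and a public user (Carol) with power $P_{\mathrm c}$, aided by a STAR-RIS with $M$ elements. The vectors $\mathbf h_{\mathrm{AR}}$ and $\mathbf h_{\mathrm{rw}}$ are the channels from Alice to the STAR-RIS and from the STAR-RIS to the warden Willie; Willie knows them, so they are treated as fixed. The reflection coefficient matrix is $\boldsymbol\Theta_{\mathrm r}=\operatorname{Diag}\{\sqrt{\beta_{\mathrm r}^1}e^{\mathrm j\phi_{\mathrm r}^1},\ldots,\sqrt{\beta_{\mathrm r}^M}e^{\mathrm j\phi_{\mathrm r}^M}\}$ with $\beta_{\mathrm r}^m\in[0,1]$ and $\phi_{\mathrm r}^m\in[0,2\pi)$. Noise uncertainty: Willie's noise power $\sigma_{\mathrm w}^2$ is a random variable with density $f_{\sigma_{\mathrm w}^2}(x)=\frac{1}{2x\ln\rho}$ for $\frac{\hat\sigma_{\mathrm w}^2}{\rho}\le x\le\rho\hat\sigma_{\mathrm w}^2$ and $0$ otherwise, where $\rho>1$ is the uncertainty parameter and $\hat\sigma_{\mathrm w}^2>0$ is the nominal noise power. Detection: Willie distinguishes the hypotheses $\mathcal H_0$ (only the public signal is sent) and $\mathcal H_1$ (both the public and the covert signals are sent). Under an infinite number of samples, the average received power is $\overline P_{\mathrm w}=\phi_1+\sigma_{\mathrm w}^2$ under $\mathcal H_0$ and $\overline P_{\mathrm w}=\phi_2+\sigma_{\mathrm w}^2$ under $\mathcal H_1$. Willie decides for $\mathcal H_1$ (decision $\mathcal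 D_1$) if $\overline P_{\mathrm w}>\tau_{\mathrm{dt}}$ and for $\mathcal H_0$ (decision $\mathcal D_0$) if $\overline P_{\mathrm w}<\tau_{\mathrm{dt}}$. The detection error probability (DEP) is the sum of the false alarm and miss detection probabilities: $$P_{\mathrm e}=\Pr(\mathcal D_1\mid\mathcal H_0)+\Pr(\mathcal D_0\mid\mathcal H_1)=\Pr(\sigma_{\mathrm w}^2>\tau_{\mathrm{dt}}-\phi_1)+\Pr(\sigma_{\mathrm w}^2<\tau_{\mathrm{dt}}-\phi_2).$$ *)

theory Defs
  imports "HOL-Probability.Probability"
begin

(* Columns of length M are vectors over a finite index type 'm with CARD('m) = M. *)

definition hermitian_prod :: "complex ^ 'm \<Rightarrow> complex ^ 'm \<Rightarrow> complex" where
  "hermitian_prod x y = (\<Sum>m\<in>UNIV. cnj (x $ m) * y $ m)"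

definition Diag :: "complex ^ 'm \<Rightarrow> complex ^ 'm ^ 'm" where
  "Diag d = (\<chi> i j. if i = j then d $ i else 0)"

definition reflection_matrix :: "complex ^ 'm ^ 'm \<Rightarrow> bool" where
  "reflection_matrix \<Theta> \<longleftrightarrow>
     (\<exists>(\<beta> :: real ^ 'm) (\<phi> :: real ^ 'm).
        (\<forall>m. 0 \<le> \<beta> $ m \<and> \<beta> $ m \<le> 1) \<and>
        (\<forall>m. 0 \<le> \<phi> $ m \<and> \<phi> $ m < 2 * pi) \<and>
        \<Theta> = Diag (\<chi> m. complex_of_real (sqrt (\<beta> $ m)) * exp (\<i> * complex_of_real (\<phi> $ m))))"

definition channel_gain :: "complex ^ 'm \<Rightarrow> complex ^ 'm ^ 'm \<Rightarrow> complex ^ 'm \<Rightarrow> real" where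
  "channel_gain h_rw \<Theta> h_AR = (cmod (hermitian_prod h_rw (\<Theta> *v h_AR)))\<^sup>2"

definition noise_density :: "real \<Rightarrow> real \<Rightarrow> real \<Rightarrow> real" where
  "noise_density \<rho> nominal x =
     (if nominal / \<rho> \<le> x \<and> x \<le> \<rho> * nominal then 1 / (2 * x * ln \<rho>) else 0)"

text \<open>
  The two hypotheses are not events of the probability space: each one fixes a
  signal power (\<open>\<phi>1\<close> or \<open>\<phi>2\<close>), and a probability "given" the hypothesis is the
  probability, over the noise power, of an event about the resulting received power.
\<close>

definition received_power :: "real \<Rightarrow> ('a \<Rightarrow> real) \<Rightarrow> 'a \<Rightarrow> real" where
  "received_power \<phi> noise \<omega> = \<phi> + noise \<omega>"

definition false_alarm_prob :: "'a measure \<Rightarrow> ('a \<Rightarrow> real) \<Rightarrow> real \<Rightarrow> real \<Rightarrow> real" where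
  "false_alarm_prob \<Omega> noise \<phi>1 \<tau> =
     measure \<Omega> {\<omega> \<in> space \<Omega>. received_power \<phi>1 noise \<omega> > \<tau>}"

definition miss_detection_prob :: "'a measure \<Rightarrow> ('a \<Rightarrow> real) \<Rightarrow> real \<Rightarrow> real \<Rightarrow> real" where
  "miss_detection_prob \<Omega> noise \<phi>2 \<tau> =
     measure \<Omega> {\<omega> \<in> space \<Omega>. received_power \<phi>2 noise \<omega> < \<tau>}"

definition detection_error_prob ::
  "'a measure \<Rightarrow> ('a \<Rightarrow> real) \<Rightarrow> real \<Rightarrow> real \<Rightarrow> real \<Rightarrow> real" where
  "detection_error_prob \<Omega> noise \<phi>1 \<phi>2 \<tau> =
     false_alarm_prob \<Omega> noise \<phi>1 \<tau> + miss_detection_prob \<Omega> noise \<phi>2 \<tau>"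

definition is_minimum_over :: "('b \<Rightarrow> real) \<Rightarrow> 'b set \<Rightarrow> real \<Rightarrow> bool" where
  "is_minimum_over f S v \<longleftrightarrow> (\<exists>x\<in>S. f x = v) \<and> (\<forall>x\<in>S. v \<le> f x)"

end

theory Submission
  imports Defs
begin

(* The noise power is log-uniform on [a, b] with a = nominal / \<rho>, b = \<rho> * nominal, so up to the
   factor 2 ln \<rho> = ln (b / a) the error probability at t = \<tau> - \<phi>1 with gap \<delta> = \<phi>2 - \<phi>1 is
   ln b - ln a - ln (t / max a (t - \<delta>)).  The ratio t / max a (t - \<delta>) increases in t up to
   t = a + \<delta> and decreases afterwards, so the optimum is t = min (a + \<delta>) b. *)

lemma nn_integral_reciprocal_Icc:
  fixes c d L :: real
  assumes "0 < c" "c \<le> d" "0 < L"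
  shows "(\<integral>\<^sup>+x. ennreal (1 / (x * L)) * indicator {c..d} x \<partial>lborel) = ennreal ((ln d - ln c) / L)"
proof -
  have "(\<integral>\<^sup>+x. ennreal (1 / (x * L)) * indicator {c..d} x \<partial>lborel) = ennreal (ln d / L - ln c / L)"
    using assms
    by (intro nn_integral_FTC_Icc[where F = "\<lambda>x. ln x / L"])
       (auto intro!: derivative_eq_intros simp: field_simps)
  then show ?thesis
    by (simp add: diff_divide_distrib)
qed

text \<open>
  The set \<open>A\<close> may contain or omit the endpoints \<open>c\<close>, \<open>d\<close>, which form a null set.
\<close>

lemma noise_prob_interval:
  fixes \<Omega> :: "'a measure" and noise :: "'a \<Rightarrow> real"
  assumes rho: "\<rho> > 1" and nominal: "nominal > 0"
    and dist: "distributed \<Omega> lborel noise (\<lambda>x. ennreal (noise_density \<rho> nominal x))"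
    and cd: "nominal / \<rho> \<le> c" "c \<le> d" "d \<le> \<rho> * nominal"
    and A: "A \<in> sets borel"
    and inner: "{c<..<d} \<subseteq> A"
    and outer: "A \<inter> {nominal / \<rho>..\<rho> * nominal} \<subseteq> {c..d}"
  shows "measure \<Omega> {\<omega> \<in> space \<Omega>. noise \<omega> \<in> A} = (ln d - ln c) / (2 * ln \<rho>)"
proof -
  have c: "0 < c"
    using rho nominal cd(1) by (smt (verit) divide_pos_pos)
  \<comment> \<open>Off the two endpoints the integrands agree pointwise: on \<open>{c..d}\<close>
    because \<open>inner\<close> puts x in \<open>A\<close> and the support of the density contains
    \<open>{c..d}\<close>; elsewhere because \<open>outer\<close> leaves only points outside
    \<open>A\<close> or outside the support.\<close>
  have "AE x in lborel. x \<noteq> c" "AE x in lborel. x \<noteq> d"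
    by (rule AE_lborel_singleton)+
  then have ae: "AE x in lborel. ennreal (noise_density \<rho> nominal x) * indicator A x
      = ennreal (1 / (x * (2 * ln \<rho>))) * indicator {c..d} x"
  proof eventually_elim
    case (elim x)
    show ?case
    proof (cases "x \<in> {c..d}")
      case True
      then have "x \<in> A"
        using elim inner by auto
      then show ?thesis
        using True cd by (auto simp: noise_density_def mult_ac)
    next
      case False
      then show ?thesis
        using outer by (auto simp: noise_density_def indicator_def)
    qed
  qed
  have "emeasure \<Omega> {\<omega> \<in> space \<Omega>. noise \<omega> \<in> A} = emeasure \<Omega> (noise -` A \<inter> space \<Omega>)"
    by (rule arg_cong[where f = "emeasure \<Omega>"]) auto
  also have "\<dots> = (\<integral>\<^sup>+x. ennreal (noise_density \<rho> nominal x) * indicator A x \<partial>lborel)"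
    using distributed_emeasure[OF dist] A by simp
  also have "\<dots> = (\<integral>\<^sup>+x. ennreal (1 / (x * (2 * ln \<rho>))) * indicator {c..d} x \<partial>lborel)"
    by (rule nn_integral_cong_AE[OF ae])
  also have "\<dots> = ennreal ((ln d - ln c) / (2 * ln \<rho>))"
    using rho c cd by (intro nn_integral_reciprocal_Icc) auto
  finally show ?thesis
    using rho c cd by (simp add: measure_def)
qed

text \<open>Both errors are interval probabilities: noise between \<tau> - \<phi>1 and the upper end
  of the support, and noise between the lower end and \<tau> - \<phi>2. The latter threshold may
  fall below the support; the \<open>max\<close> then makes the interval degenerate and its log
  difference zero. The hypothesis \<phi>1 \<le> \<phi>2 keeps \<tau> - \<phi>2 from exceeding the
  upper end.\<close>

lemma detection_error_prob_eq:
  fixes \<Omega> :: "'a measure" and noise :: "'a \<Rightarrow> real"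
  assumes rho: "\<rho> > 1" and nominal: "nominal > 0"
    and dist: "distributed \<Omega> lborel noise (\<lambda>x. ennreal (noise_density \<rho> nominal x))"
    and le: "\<phi>1 \<le> \<phi>2"
    and \<tau>: "\<tau> \<in> {nominal / \<rho> + \<phi>1 .. \<rho> * nominal + \<phi>1}"
  shows "detection_error_prob \<Omega> noise \<phi>1 \<phi>2 \<tau> =
    (ln (\<rho> * nominal) - ln (\<tau> - \<phi>1) + (ln (max (nominal / \<rho>) (\<tau> - \<phi>2)) - ln (nominal / \<rho>)))
      / (2 * ln \<rho>)"
proof -
  have "false_alarm_prob \<Omega> noise \<phi>1 \<tau> = measure \<Omega> {\<omega> \<in> space \<Omega>. noise \<omega> \<in> {\<tau> - \<phi>1<..}}"
    unfolding false_alarm_prob_def received_power_def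
    by (rule arg_cong[where f = "measure \<Omega>"]) auto
  also have "\<dots> = (ln (\<rho> * nominal) - ln (\<tau> - \<phi>1)) / (2 * ln \<rho>)"
    using \<tau> by (intro noise_prob_interval[OF rho nominal dist]) auto
  finally have fa: "false_alarm_prob \<Omega> noise \<phi>1 \<tau> = (ln (\<rho> * nominal) - ln (\<tau> - \<phi>1)) / (2 * ln \<rho>)" .
  have "miss_detection_prob \<Omega> noise \<phi>2 \<tau> = measure \<Omega> {\<omega> \<in> space \<Omega>. noise \<omega> \<in> {..<\<tau> - \<phi>2}}"
    unfolding miss_detection_prob_def received_power_def
    by (rule arg_cong[where f = "measure \<Omega>"]) auto
  also have "\<dots> = (ln (max (nominal / \<rho>) (\<tau> - \<phi>2)) - ln (nominal / \<rho>)) / (2 * ln \<rho>)"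
    using \<tau> le by (intro noise_prob_interval[OF rho nominal dist]) auto
  finally show ?thesis
    by (simp add: detection_error_prob_def fa add_divide_distrib)
qed

text \<open>Optimality of t = a + \<delta> with denominators cleared: the quotient t / max a (t -
  \<delta>) never exceeds its value (a + \<delta>) / a there. The product form is ready for taking
  logarithms.\<close>

lemma max_mult_shift_le:
  fixes a t \<delta> :: real
  assumes "0 < a" "a \<le> t" "0 \<le> \<delta>"
  shows "a * t \<le> (a + \<delta>) * max a (t - \<delta>)"
proof (cases "t \<le> a + \<delta>")
  case True
  then have "a * t \<le> (a + \<delta>) * a"
    using assms by (simp add: mult.commute)
  also have "\<dots> \<le> (a + \<delta>) * max a (t - \<delta>)"
    using assms by (intro mult_left_mono) auto
  finally show ?thesis .
next
  case False
  \<comment> \<open>This product is exactly (a + \<delta>) * (t - \<delta>) - a * t.\<close>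
  then have "0 \<le> \<delta> * (t - \<delta> - a)"
    using assms by simp
  then show ?thesis
    using False by (simp add: algebra_simps max_def)
qed

theorem mainTheorem2:
  fixes \<Omega> :: "'a measure"
    and noise :: "'a \<Rightarrow> real"
    and \<rho> nominal P_b P_c \<phi>1 \<phi>2 :: real
    and h_rw h_AR :: "complex ^ 'm"
    and \<Theta> :: "complex ^ 'm ^ 'm"
  assumes "prob_space \<Omega>"
    and "\<rho> > 1" and "nominal > 0" and "P_b \<ge> 0" and "P_c \<ge> 0"
    and "reflection_matrix \<Theta>"
    and "distributed \<Omega> lborel noise (\<lambda>x. ennreal (noise_density \<rho> nominal x))"
    and "\<phi>1 = P_c * channel_gain h_rw \<Theta> h_AR"
    and "\<phi>2 = (P_b + P_c) * channel_gain h_rw \<Theta> h_AR"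
  shows "is_minimum_over (detection_error_prob \<Omega> noise \<phi>1 \<phi>2)
           {nominal / \<rho> + \<phi>1 .. \<rho> * nominal + \<phi>1}
           (if \<phi>2 - \<phi>1 \<le> (\<rho>\<^sup>2 - 1) * nominal / \<rho>
            then 1 - ln (1 + \<rho> * (\<phi>2 - \<phi>1) / nominal) / (2 * ln \<rho>)
            else 0)"
proof -
  define a b \<delta> where "a = nominal / \<rho>" and "b = \<rho> * nominal" and "\<delta> = \<phi>2 - \<phi>1"
  have a: "0 < a"
    using assms(2,3) by (simp add: a_def)
  \<comment> \<open>The support endpoints differ by the factor \<open>\<rho>\<^sup>2\<close>, so the
    normalising constant 2 ln \<rho> is the log-length of the support.\<close>
  have b_eq: "b = \<rho>\<^sup>2 * a"
    using assms(2) by (simp add: a_def b_def power2_eq_square)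
  have "1 < \<rho>\<^sup>2"
    using assms(2) by (simp add: one_less_power)
  then have ab: "a < b"
    using a by (simp add: b_eq)
  have L: "2 * ln \<rho> = ln b - ln a" "0 < ln b - ln a"
    using assms(2) a by (simp_all add: b_eq ln_mult ln_realpow)
  have "\<delta> = P_b * channel_gain h_rw \<Theta> h_AR"
    using assms(8,9) by (simp add: \<delta>_def algebra_simps)
  then have \<delta>: "0 \<le> \<delta>"
    using assms(4) by (simp add: channel_gain_def)
  have dep: "detection_error_prob \<Omega> noise \<phi>1 \<phi>2 \<tau> =
      (ln b - ln (\<tau> - \<phi>1) + (ln (max a (\<tau> - \<phi>1 - \<delta>)) - ln a)) / (ln b - ln a)"
    if "\<tau> \<in> {a + \<phi>1 .. b + \<phi>1}" for \<tau>
    using detection_error_prob_eq[OF assms(2,3,7), of \<phi>1 \<phi>2 \<tau>] that \<delta> L(1)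
    by (simp add: a_def b_def \<delta>_def)
  have threshold: "(\<rho>\<^sup>2 - 1) * nominal / \<rho> = b - a"
    by (simp add: b_eq a_def algebra_simps diff_divide_distrib)
  have ratio: "1 + \<rho> * (\<phi>2 - \<phi>1) / nominal = (a + \<delta>) / a"
    using assms(2,3) by (simp add: a_def \<delta>_def field_simps)
  have v: "1 - ln (1 + \<rho> * (\<phi>2 - \<phi>1) / nominal) / (2 * ln \<rho>) = (ln b - ln (a + \<delta>)) / (ln b - ln a)"
    unfolding ratio L(1) using a \<delta> L(2) by (simp add: ln_div field_simps)
  have "is_minimum_over (detection_error_prob \<Omega> noise \<phi>1 \<phi>2) {a + \<phi>1 .. b + \<phi>1}
      (if \<delta> \<le> b - a then (ln b - ln (a + \<delta>)) / (ln b - ln a) else 0)"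
  proof (cases "\<delta> \<le> b - a")
    case True
    \<comment> \<open>This is the largest threshold without missed detections: the
      \<open>max\<close> equals a, and only the false alarm term survives. The case assumption keeps
      it in the admissible range.\<close>
    have "detection_error_prob \<Omega> noise \<phi>1 \<phi>2 (a + \<delta> + \<phi>1) = (ln b - ln (a + \<delta>)) / (ln b - ln a)"
      using True \<delta> by (subst dep) auto
    moreover have "a + \<delta> + \<phi>1 \<in> {a + \<phi>1 .. b + \<phi>1}"
      using True \<delta> by auto
    moreover have "(ln b - ln (a + \<delta>)) / (ln b - ln a) \<le> detection_error_prob \<Omega> noise \<phi>1 \<phi>2 \<tau>"
      if \<tau>: "\<tau> \<in> {a + \<phi>1 .. b + \<phi>1}" for \<tau>
    proof -
      define t where "t = \<tau> - \<phi>1"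
      have t: "a \<le> t"
        using \<tau> by (simp add: t_def)
      \<comment> \<open>After splitting the logarithms, this compares the numerators of the two
        error probabilities.\<close>
      have "ln (a * t) \<le> ln ((a + \<delta>) * max a (t - \<delta>))"
        using max_mult_shift_le[OF a t \<delta>] a t by (intro ln_mono) simp_all
      moreover have "0 < max a (t - \<delta>)"
        using a by simp
      ultimately have "ln a + ln t \<le> ln (a + \<delta>) + ln (max a (t - \<delta>))"
        using a t \<delta> by (simp add: ln_mult)
      then show ?thesis
        unfolding dep[OF \<tau>] t_def[symmetric] using L(2) by (intro divide_right_mono) auto
    qed
    ultimately show ?thesis
      using True unfolding is_minimum_over_def by auto
  next
    case False
    \<comment> \<open>The gap exceeds the length of the support, so the received powers under the
      two hypotheses have disjoint ranges. At the top threshold there is no false alarm, and b -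
      \<delta> < a rules out a miss.\<close>
    have "detection_error_prob \<Omega> noise \<phi>1 \<phi>2 (b + \<phi>1) = 0"
      using False ab by (subst dep) auto
    moreover have "0 \<le> detection_error_prob \<Omega> noise \<phi>1 \<phi>2 \<tau>" for \<tau>
      by (simp add: detection_error_prob_def false_alarm_prob_def miss_detection_prob_def)
    ultimately show ?thesis
      using False ab unfolding is_minimum_over_def by auto
  qed
  then show ?thesis
    unfolding v threshold by (simp add: a_def b_def \<delta>_def)
qed

end
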